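(* Let $\alpha\in\,]0,1]$ and let $\mathbb{T}$ be a time scale. Assume $f:\mathbb{T}\to\mathbb{R}$ and let $t\in\mathbb{T}^{\kappa}$. The following properties hold. (i) If $f$ is conformable fractional differentiable of order $\alpha$ at $t>0$, then $f$ is continuous at $t$. (ii) If $f$ is continuous at $t$ and $t$ is right-scattered, then $f$ is conformable fractional differentiable of order $\alpha$ at $t$ with $$T_\alpha(f)(t)=\frac{f(\sigma(t))-f(t)}{\mu(t)}\,t^{1-\alpha}.$$ (iii) If $t$ is right-dense, then $f$ is conformable fractional differentiable of order $\alpha$ at $t$ if, and only if, the limit $\lim_{s\to t}\frac{f(t)-f(s)}{t-s}\,t^{1-\alpha}$ exists as a finite number. In this case, $$T_\alpha(f)(t)=\lim_{s\to t}\frac{f(t)-f(s)}{t-s}\,t^{1-\alpha}.$$ (iv) If $f$ is conformable fractional differentiable of order $\alpha$ at $t$, then $$f(\sigma(t))=f(t)+\mu(t)\,t^{\alpha-1}\,T_\alpha(f)(t).$$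
   Context: A time scale $\mathbb{T}$ is a nonempty closed subset of $\mathbb{R}$ (with the subspace topology). The forward jump is $\sigma(t)=\inf\{s\in\mathbb{T}:s>t\}$ (with $\inf\emptyset=\sup\mathbb{T}$), and $\mu(t)=\sigma(t)-t$. A point $t$ is right-scattered if $\sigma(t)>t$ and right-dense if $\sigma(t)=t$. $\mathbb{T}^{\kappa}$ is $\mathbb{T}$ with its maximum removed if $\mathbb{T}$ has a left-scattered maximum (one isolated from the left), and $\mathbb{T}^{\kappa}=\mathbb{T}$ otherwise. Conformable fractional derivative: let $f:\mathbb{T}\to\mathbb{R}$, $t\in\mathbb{T}^{\kappa}$ and $\alpha\in\,]0,1]$. For $t>0$, $T_\alpha(f)(t)$ is the number (provided it exists) with the property that, given any $\epsilon>0$, there is $\delta>0$ such that $$\bigl|[f(\sigma(t))-f(s)]\,t^{1-\alpha}-T_\alpha(f)(t)[\sigma(t)-s]\bigr|\le\epsilon|\sigma(t)-s|$$ for all $s\in\,]t-\delta,t+\delta[\,\cap\mathbb{T}$. The conformable fractional derivative at $0$ is defined as $T_\alpha(f)(0)=\lim_{t\to0^+}T_\alpha(f)(t)$. $f$ is called conformable fractional differentiable of order $\alpha$ at $t$ if $T_\alpha(f)(t)$ exists.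
   Formalization: Parts (ii) and (iii) are stated for t > 0 only: T_α(f)(t) is undefined for t < 0, and at t = 0 both fail, e.g. (iii) for T = [0,∞), α < 1, f(s) = s^α/α, where T_α(f)(0) = 1 but the limit is 0. *)

theory Defs
  imports "HOL-Analysis.Analysis"
begin

definition time_scale :: "real set \<Rightarrow> bool" where
  "time_scale T \<longleftrightarrow> T \<noteq> {} \<and> closed T"

(* On real, Inf {} and Sup {} are unspecified, so the conventions
   inf {} = sup T and sup {} = inf T are written out. *)
definition forward_jump :: "real set \<Rightarrow> real \<Rightarrow> real" where
  "forward_jump T t =
     (if {s \<in> T. s > t} = {} then Sup T else Inf {s \<in> T. s > t})"

definition backward_jump :: "real set \<Rightarrow> real \<Rightarrow> real" where
  "backward_jump T t =
     (if {s \<in> T. s < t} = {} then Inf T else Sup {s \<in> T. s < t})"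

definition graininess :: "real set \<Rightarrow> real \<Rightarrow> real" where
  "graininess T t = forward_jump T t - t"

definition right_scattered :: "real set \<Rightarrow> real \<Rightarrow> bool" where
  "right_scattered T t \<longleftrightarrow> forward_jump T t > t"

definition right_dense :: "real set \<Rightarrow> real \<Rightarrow> bool" where
  "right_dense T t \<longleftrightarrow> forward_jump T t = t"

definition left_scattered :: "real set \<Rightarrow> real \<Rightarrow> bool" where
  "left_scattered T t \<longleftrightarrow> backward_jump T t < t"

(* The set T^kappa. Because of sup {} = inf T, the point of a one-point
   time scale is not left-scattered and is therefore kept. *)
definition time_scale_kappa :: "real set \<Rightarrow> real set" where
  "time_scale_kappa T = T - {m \<in> T. (\<forall>s\<in>T. s \<le> m) \<and> left_scattered T m}"

(* Functions on a time scale T are total functions of which only the values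
   on T are used; forward_jump T t lies in T whenever t does. *)
definition has_conf_deriv_pos ::
  "real set \<Rightarrow> real \<Rightarrow> (real \<Rightarrow> real) \<Rightarrow> real \<Rightarrow> real \<Rightarrow> bool" where
  "has_conf_deriv_pos T \<alpha> f D t \<longleftrightarrow>
     (\<forall>\<epsilon>>0. \<exists>\<delta>>0. \<forall>s \<in> {t - \<delta><..<t + \<delta>} \<inter> T.
        \<bar>(f (forward_jump T t) - f s) * t powr (1 - \<alpha>) - D * (forward_jump T t - s)\<bar>
          \<le> \<epsilon> * \<bar>forward_jump T t - s\<bar>)"

definition conf_deriv_pos :: "real set \<Rightarrow> real \<Rightarrow> (real \<Rightarrow> real) \<Rightarrow> real \<Rightarrow> real" where
  "conf_deriv_pos T \<alpha> f t = (THE D. has_conf_deriv_pos T \<alpha> f D t)"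

(* At 0 the derivative is the one-sided limit of the derivatives at positive
   points. It requires these to exist near 0 and 0 to be a limit of positive
   points, since otherwise every number would vacuously be a limit.
   At negative points no derivative is defined. *)
definition has_conf_deriv ::
  "real set \<Rightarrow> real \<Rightarrow> (real \<Rightarrow> real) \<Rightarrow> real \<Rightarrow> real \<Rightarrow> bool" where
  "has_conf_deriv T \<alpha> f D t \<longleftrightarrow>
     t \<in> time_scale_kappa T \<and>
     (t > 0 \<and> has_conf_deriv_pos T \<alpha> f D t \<or>
      t = 0 \<and>
        (let F = at 0 within (time_scale_kappa T \<inter> {0<..}) in
          F \<noteq> bot \<and>
          (\<forall>\<^sub>F s in F. \<exists>D'. has_conf_deriv_pos T \<alpha> f D' s) \<and>
          ((\<lambda>s. conf_deriv_pos T \<alpha> f s) \<longlongrightarrow> D) F))"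

definition conf_differentiable ::
  "real set \<Rightarrow> real \<Rightarrow> (real \<Rightarrow> real) \<Rightarrow> real \<Rightarrow> bool" where
  "conf_differentiable T \<alpha> f t \<longleftrightarrow> (\<exists>D. has_conf_deriv T \<alpha> f D t)"

definition conf_deriv :: "real set \<Rightarrow> real \<Rightarrow> (real \<Rightarrow> real) \<Rightarrow> real \<Rightarrow> real" where
  "conf_deriv T \<alpha> f t = (THE D. has_conf_deriv T \<alpha> f D t)"

end

theory Submission imports Defs
begin

text \<open>
  Write \<open>\<sigma>\<close> for the forward jump of \<open>t\<close> and \<open>q s\<close> for the quotient
  \<open>(f \<sigma> - f s) * t powr (1 - \<alpha>) / (\<sigma> - s)\<close>. Dividing the defining inequality by \<open>\<bar>\<sigma> - s\<bar>\<close> turns it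
  into \<open>\<bar>q s - D\<bar> \<le> \<epsilon>\<close>, and this is possible for every \<open>s \<noteq> t\<close> close to \<open>t\<close>, whether \<open>t\<close> is
  right-scattered or right-dense. The point \<open>s = t\<close> itself, which the definition does not exclude,
  contributes the equation \<open>(f \<sigma> - f t) * t powr (1 - \<alpha>) = D * (\<sigma> - t)\<close>. Hence, at a positive point,
  \<open>D\<close> is a derivative iff \<open>q\<close> tends to \<open>D\<close> along the time scale and this equation holds
  (\<open>has_conf_deriv_pos_iff_tendsto\<close>). All four parts are read off from this:

  \<^item> solving for \<open>f s\<close> in terms of \<open>q s\<close> and passing to the limit, the equation identifies the limit
    as \<open>f t\<close>, which is continuity;
  \<^item> if \<open>t\<close> is right-scattered, \<open>q\<close> is continuous at \<open>t\<close> as soon as \<open>f\<close> is, and the equation says that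
    \<open>D = q t\<close>;
  \<^item> if \<open>t\<close> is right-dense, the equation is void and \<open>q\<close> is the ordinary difference quotient;
  \<^item> the last formula is the equation, divided by \<open>t powr (1 - \<alpha>)\<close>.

  The derivative at \<open>0\<close> exists only if \<open>0\<close> is a limit of positive points, hence right-dense, and
  there the last formula is trivial. If the time scale is a single positive point, every number is
  a derivative there, so \<^term>\<open>conf_deriv\<close> is an unspecified number; but then the graininess vanishes and the filter of
  punctured neighbourhoods is trivial, so nothing is claimed about that number.
\<close>

section \<open>The forward jump\<close>

lemma forward_jump_ge:
  assumes "t \<in> T"
  shows "t \<le> forward_jump T t"
proof (cases "{s \<in> T. s > t} = {}")
  case True
  then have "Sup T = t"
    using assms by (intro cSup_eq_maximum) force+
  then show ?thesis
    using True by (simp add: forward_jump_def)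
next
  case False
  then have "t \<le> Inf {s \<in> T. s > t}"
    by (intro cInf_greatest) auto
  with False show ?thesis
    unfolding forward_jump_def by (simp only: if_False)
qed

lemma forward_jump_le:
  assumes "s \<in> T" and "t < s"
  shows "forward_jump T t \<le> s"
proof -
  have "bdd_below {u \<in> T. u > t}"
    by (rule bdd_belowI[where m = t]) auto
  then have "Inf {u \<in> T. u > t} \<le> s"
    using assms by (intro cInf_lower) auto
  then show ?thesis
    using assms by (auto simp: forward_jump_def)
qed

lemma right_dense_if_limit_from_right:
  assumes "t \<in> T" and "at t within (T \<inter> {t<..}) \<noteq> bot"
  shows "forward_jump T t = t"
proof (rule ccontr)
  assume "forward_jump T t \<noteq> t"
  then have "t < forward_jump T t"
    using forward_jump_ge[OF assms(1)] by simp
  then have "eventually (\<lambda>s. s < forward_jump T t) (at t within (T \<inter> {t<..}))"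
    by (intro order_tendstoD(2)[OF tendsto_ident_at])
  moreover have "eventually (\<lambda>s. s \<in> T \<inter> {t<..}) (at t within (T \<inter> {t<..}))"
    by (simp add: eventually_at_filter)
  ultimately have "eventually (\<lambda>s. False) (at t within (T \<inter> {t<..}))"
    by eventually_elim (use forward_jump_le in force)
  then show False
    using assms(2) by (simp add: eventually_False)
qed

section \<open>The derivative at positive points as a limit\<close>

definition jump_quotient ::
  "real set \<Rightarrow> real \<Rightarrow> (real \<Rightarrow> real) \<Rightarrow> real \<Rightarrow> real \<Rightarrow> real" where
  "jump_quotient T \<alpha> f t s =
     (f (forward_jump T t) - f s) * t powr (1 - \<alpha>) / (forward_jump T t - s)"

text \<open>
  For a right-scattered \<open>t\<close> this holds because \<open>s\<close> stays near \<open>t\<close>, away from its forward jump; for a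
  right-dense \<open>t\<close> because \<open>s = t\<close> is excluded.
\<close>

lemma eventually_neq_forward_jump:
  "eventually (\<lambda>s. s \<noteq> forward_jump T t) (at t within T)"
proof (cases "forward_jump T t = t")
  case True
  then show ?thesis
    by (simp add: eventually_at_filter)
next
  case False
  then show ?thesis
    by (intro tendsto_imp_eventually_ne[OF tendsto_ident_at]) auto
qed

lemma abs_diff_le_iff_quotient:
  fixes a d D e :: real
  assumes "d \<noteq> 0"
  shows "\<bar>a - D * d\<bar> \<le> e * \<bar>d\<bar> \<longleftrightarrow> \<bar>a / d - D\<bar> \<le> e"
proof -
  have "a - D * d = (a / d - D) * d"
    using assms by (simp add: field_simps)
  then have "\<bar>a - D * d\<bar> = \<bar>a / d - D\<bar> * \<bar>d\<bar>"
    by (simp add: abs_mult)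
  then show ?thesis
    using assms by simp
qed

lemma tendsto_iff_le:
  fixes g :: "'a \<Rightarrow> real"
  shows "(g \<longlongrightarrow> l) F \<longleftrightarrow> (\<forall>e>0. eventually (\<lambda>x. \<bar>g x - l\<bar> \<le> e) F)"
proof
  assume "(g \<longlongrightarrow> l) F"
  then show "\<forall>e>0. eventually (\<lambda>x. \<bar>g x - l\<bar> \<le> e) F"
    by (force simp: tendsto_iff dist_real_def elim: eventually_mono)
next
  assume *: "\<forall>e>0. eventually (\<lambda>x. \<bar>g x - l\<bar> \<le> e) F"
  show "(g \<longlongrightarrow> l) F"
    unfolding tendsto_iff dist_real_def
  proof (intro allI impI)
    fix e :: real
    assume "e > 0"
    then have "e / 2 > 0"
      by simp
    with * have "eventually (\<lambda>x. \<bar>g x - l\<bar> \<le> e / 2) F"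
      by blast
    then show "eventually (\<lambda>x. \<bar>g x - l\<bar> < e) F"
      by eventually_elim (use \<open>e > 0\<close> in simp)
  qed
qed

text \<open>
  The defining inequality at the point \<open>s = t\<close> holds for every \<open>\<epsilon>\<close>, which forces equality there. At the
  remaining points near \<open>t\<close> it can be divided by \<open>\<bar>\<sigma> - s\<bar>\<close>.
\<close>

theorem has_conf_deriv_pos_iff_tendsto:
  assumes "t \<in> T"
  shows "has_conf_deriv_pos T \<alpha> f D t \<longleftrightarrow>
     (f (forward_jump T t) - f t) * t powr (1 - \<alpha>) = D * (forward_jump T t - t) \<and>
     (jump_quotient T \<alpha> f t \<longlongrightarrow> D) (at t within T)"
proof -
  define \<sigma> where "\<sigma> = forward_jump T t"
  define P where "P e s \<longleftrightarrow>
    \<bar>(f \<sigma> - f s) * t powr (1 - \<alpha>) - D * (\<sigma> - s)\<bar> \<le> e * \<bar>\<sigma> - s\<bar>" for e s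
  have ball: "(\<exists>\<delta>>0. \<forall>s \<in> {t - \<delta><..<t + \<delta>} \<inter> T. P e s) \<longleftrightarrow>
      P e t \<and> eventually (P e) (at t within T)" for e
  proof -
    have "s \<in> {t - \<delta><..<t + \<delta>} \<longleftrightarrow> dist s t < \<delta>" for s \<delta>
      by (auto simp: dist_real_def)
    then show ?thesis
      unfolding eventually_at using assms by (metis IntD1 IntD2 IntI dist_self)
  qed
  have at_t: "(\<forall>e>0. P e t) \<longleftrightarrow> (f \<sigma> - f t) * t powr (1 - \<alpha>) = D * (\<sigma> - t)" (is "_ \<longleftrightarrow> ?a = ?b")
  proof
    assume *: "\<forall>e>0. P e t"
    have "(\<lambda>n. inverse (real (Suc n)) * \<bar>\<sigma> - t\<bar>) \<longlonglongrightarrow> 0 * \<bar>\<sigma> - t\<bar>"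
      by (intro tendsto_intros LIMSEQ_inverse_real_of_nat)
    then have "\<bar>?a - ?b\<bar> \<le> 0 * \<bar>\<sigma> - t\<bar>"
      by (rule LIMSEQ_le_const) (use * in \<open>auto simp: P_def simp del: of_nat_Suc\<close>)
    then show "?a = ?b"
      by simp
  qed (simp add: P_def)
  have near_t: "eventually (P e) (at t within T) \<longleftrightarrow>
      eventually (\<lambda>s. \<bar>jump_quotient T \<alpha> f t s - D\<bar> \<le> e) (at t within T)" for e
  proof (rule eventually_cong[OF eventually_neq_forward_jump])
    fix s
    assume "s \<noteq> forward_jump T t"
    then show "P e s \<longleftrightarrow> \<bar>jump_quotient T \<alpha> f t s - D\<bar> \<le> e"
      unfolding P_def jump_quotient_def \<sigma>_def by (intro abs_diff_le_iff_quotient) simp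
  qed
  have "has_conf_deriv_pos T \<alpha> f D t \<longleftrightarrow>
      (\<forall>e>0. P e t) \<and> (\<forall>e>0. eventually (P e) (at t within T))"
    unfolding has_conf_deriv_pos_def P_def[symmetric] \<sigma>_def[symmetric] ball by blast
  then show ?thesis
    unfolding at_t near_t tendsto_iff_le \<sigma>_def .
qed

section \<open>Consequences\<close>

text \<open>
  Away from the forward jump, \<open>f s\<close> is \<open>f \<sigma> - q s * (\<sigma> - s) / t powr (1 - \<alpha>)\<close>. The limit of this
  expression is \<open>f t\<close>, by the equation at \<open>s = t\<close>.
\<close>

lemma has_conf_deriv_pos_imp_continuous:
  assumes "t \<in> T" and "0 < t" and "has_conf_deriv_pos T \<alpha> f D t"
  shows "continuous (at t within T) f"
proof -
  define \<sigma> where "\<sigma> = forward_jump T t"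
  define c where "c = t powr (1 - \<alpha>)"
  have "c > 0"
    using assms(2) by (simp add: c_def)
  have eq: "(f \<sigma> - f t) * c = D * (\<sigma> - t)"
    and lim: "(jump_quotient T \<alpha> f t \<longlongrightarrow> D) (at t within T)"
    using assms has_conf_deriv_pos_iff_tendsto unfolding \<sigma>_def c_def by blast+
  have "((\<lambda>s. f \<sigma> - jump_quotient T \<alpha> f t s * (\<sigma> - s) / c) \<longlongrightarrow> f \<sigma> - D * (\<sigma> - t) / c)
      (at t within T)"
    using \<open>c > 0\<close> by (intro tendsto_intros lim) simp
  also have "f \<sigma> - D * (\<sigma> - t) / c = f t"
    using \<open>c > 0\<close> by (simp flip: eq)
  finally have "((\<lambda>s. f \<sigma> - jump_quotient T \<alpha> f t s * (\<sigma> - s) / c) \<longlongrightarrow> f t) (at t within T)" .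
  moreover have "eventually (\<lambda>s. f \<sigma> - jump_quotient T \<alpha> f t s * (\<sigma> - s) / c = f s) (at t within T)"
    using eventually_neq_forward_jump[where T = T and t = t]
    by eventually_elim (use \<open>c > 0\<close> in \<open>simp add: jump_quotient_def \<sigma>_def c_def\<close>)
  ultimately show ?thesis
    unfolding continuous_within by (rule Lim_transform_eventually)
qed

lemma has_conf_deriv_pos_right_scattered:
  assumes "t \<in> T" and "right_scattered T t" and "continuous (at t within T) f"
  shows "has_conf_deriv_pos T \<alpha> f (jump_quotient T \<alpha> f t t) t"
proof -
  have "(jump_quotient T \<alpha> f t \<longlongrightarrow> jump_quotient T \<alpha> f t t) (at t within T)"
    unfolding jump_quotient_def using assms(2,3)
    by (intro tendsto_intros) (auto simp: right_scattered_def continuous_within)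
  then show ?thesis
    using assms(1,2) by (simp add: has_conf_deriv_pos_iff_tendsto jump_quotient_def right_scattered_def)
qed

lemma has_conf_deriv_pos_right_dense:
  assumes "t \<in> T" and "right_dense T t"
  shows "has_conf_deriv_pos T \<alpha> f D t \<longleftrightarrow>
     ((\<lambda>s. (f t - f s) / (t - s) * t powr (1 - \<alpha>)) \<longlongrightarrow> D) (at t within T)"
  using assms
  by (simp add: has_conf_deriv_pos_iff_tendsto right_dense_def jump_quotient_def[abs_def])

text \<open>
  At a right-scattered point the derivative is determined by the value at \<open>s = t\<close>, otherwise by
  uniqueness of limits. The excluded case is that of a right-dense isolated point.
\<close>

lemma has_conf_deriv_pos_unique:
  assumes "t \<in> T" and "right_scattered T t \<or> at t within T \<noteq> bot"
    and "has_conf_deriv_pos T \<alpha> f D t" and "has_conf_deriv_pos T \<alpha> f D' t"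
  shows "D = D'"
  using assms(2)
proof
  assume "right_scattered T t"
  then show ?thesis
    using assms has_conf_deriv_pos_iff_tendsto[OF assms(1)]
    by (metis diff_gt_0_iff_gt less_irrefl mult_right_cancel right_scattered_def)
next
  assume "at t within T \<noteq> bot"
  then show ?thesis
    using assms has_conf_deriv_pos_iff_tendsto[OF assms(1)] tendsto_unique by metis
qed

lemma has_conf_deriv_iff_pos:
  assumes "t \<in> time_scale_kappa T" and "0 < t"
  shows "has_conf_deriv T \<alpha> f D t \<longleftrightarrow> has_conf_deriv_pos T \<alpha> f D t"
  using assms by (simp add: has_conf_deriv_def)

lemma conf_deriv_eqI:
  assumes "t \<in> time_scale_kappa T" and "0 < t"
    and "right_scattered T t \<or> at t within T \<noteq> bot" and "has_conf_deriv_pos T \<alpha> f D t"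
  shows "conf_deriv T \<alpha> f t = D"
proof -
  have "t \<in> T"
    using assms(1) by (simp add: time_scale_kappa_def)
  then show ?thesis
    unfolding conf_deriv_def has_conf_deriv_iff_pos[OF assms(1,2)]
    using assms(3,4) has_conf_deriv_pos_unique by (intro the_equality) blast+
qed

lemma conf_differentiable_imp_jump_formula:
  assumes kappa: "t \<in> time_scale_kappa T" and diff: "conf_differentiable T \<alpha> f t"
  shows "f (forward_jump T t) = f t + graininess T t * t powr (\<alpha> - 1) * conf_deriv T \<alpha> f t"
proof -
  have "t \<in> T"
    using kappa by (simp add: time_scale_kappa_def)
  obtain D where D: "has_conf_deriv T \<alpha> f D t"
    using diff by (auto simp: conf_differentiable_def)
  consider (dense) "forward_jump T t = t" | (scattered) "right_scattered T t"
    using forward_jump_ge[OF \<open>t \<in> T\<close>] by (force simp: right_scattered_def)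
  then show ?thesis
  proof cases
    case dense
    then show ?thesis
      by (simp add: graininess_def)
  next
    case scattered
    have "0 < t"
    proof (rule ccontr)
      assume "\<not> 0 < t"
      with D have "t = 0" and "at t within (time_scale_kappa T \<inter> {t<..}) \<noteq> bot"
        by (auto simp: has_conf_deriv_def Let_def)
      moreover have "at t within (time_scale_kappa T \<inter> {t<..}) \<le> at t within (T \<inter> {t<..})"
        by (intro at_le) (auto simp: time_scale_kappa_def)
      ultimately have "at t within (T \<inter> {t<..}) \<noteq> bot"
        using bot.extremum_uniqueI by metis
      then show False
        using right_dense_if_limit_from_right[OF \<open>t \<in> T\<close>] scattered
        by (simp add: right_scattered_def)
    qed
    then have pos: "has_conf_deriv_pos T \<alpha> f D t"
      using D kappa has_conf_deriv_iff_pos by blast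
    then have "conf_deriv T \<alpha> f t = D"
      using conf_deriv_eqI kappa \<open>0 < t\<close> scattered by blast
    moreover have "(f (forward_jump T t) - f t) * t powr (1 - \<alpha>) = D * graininess T t"
      using pos has_conf_deriv_pos_iff_tendsto[OF \<open>t \<in> T\<close>] unfolding graininess_def by blast
    moreover have "t powr (1 - \<alpha>) * t powr (\<alpha> - 1) = 1"
      using \<open>0 < t\<close> by (simp flip: powr_add)
    ultimately have "f (forward_jump T t) - f t = D * graininess T t * t powr (\<alpha> - 1)"
      by (metis mult.assoc mult.right_neutral)
    then show ?thesis
      using \<open>conf_deriv T \<alpha> f t = D\<close> by (simp add: algebra_simps)
  qed
qed

theorem theorem4:
  fixes T :: "real set" and f :: "real \<Rightarrow> real" and \<alpha> t :: real
  assumes "time_scale T" and "0 < \<alpha>" and "\<alpha> \<le> 1" and "t \<in> time_scale_kappa T"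
  shows
    "(t > 0 \<and> conf_differentiable T \<alpha> f t \<longrightarrow> continuous (at t within T) f) \<and>
     (t > 0 \<and> continuous (at t within T) f \<and> right_scattered T t \<longrightarrow>
        conf_differentiable T \<alpha> f t \<and>
        conf_deriv T \<alpha> f t =
          (f (forward_jump T t) - f t) / graininess T t * t powr (1 - \<alpha>)) \<and>
     (t > 0 \<and> right_dense T t \<longrightarrow>
        (conf_differentiable T \<alpha> f t \<longleftrightarrow>
           (\<exists>L. ((\<lambda>s. (f t - f s) / (t - s) * t powr (1 - \<alpha>)) \<longlongrightarrow> L) (at t within T))) \<and>
        (conf_differentiable T \<alpha> f t \<longrightarrow>
           ((\<lambda>s. (f t - f s) / (t - s) * t powr (1 - \<alpha>)) \<longlongrightarrow> conf_deriv T \<alpha> f t)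
             (at t within T))) \<and>
     (conf_differentiable T \<alpha> f t \<longrightarrow>
        f (forward_jump T t) =
          f t + graininess T t * t powr (\<alpha> - 1) * conf_deriv T \<alpha> f t)"
proof -
  have "t \<in> T"
    using assms(4) by (simp add: time_scale_kappa_def)
  note iff_pos = has_conf_deriv_iff_pos[OF assms(4)]
  have "continuous (at t within T) f" if "0 < t" "conf_differentiable T \<alpha> f t"
    using that has_conf_deriv_pos_imp_continuous[OF \<open>t \<in> T\<close>] iff_pos
    by (auto simp: conf_differentiable_def)
  moreover have "conf_differentiable T \<alpha> f t \<and>
      conf_deriv T \<alpha> f t = (f (forward_jump T t) - f t) / graininess T t * t powr (1 - \<alpha>)"
    if "0 < t" "continuous (at t within T) f" "right_scattered T t"
  proof -
    have pos: "has_conf_deriv_pos T \<alpha> f (jump_quotient T \<alpha> f t t) t"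
      using has_conf_deriv_pos_right_scattered \<open>t \<in> T\<close> that by blast
    then have "conf_deriv T \<alpha> f t = jump_quotient T \<alpha> f t t"
      using conf_deriv_eqI assms(4) that by blast
    then show ?thesis
      using pos iff_pos[OF \<open>0 < t\<close>]
      by (auto simp: conf_differentiable_def jump_quotient_def graininess_def)
  qed
  moreover have
    "(conf_differentiable T \<alpha> f t \<longleftrightarrow>
        (\<exists>L. ((\<lambda>s. (f t - f s) / (t - s) * t powr (1 - \<alpha>)) \<longlongrightarrow> L) (at t within T))) \<and>
     (conf_differentiable T \<alpha> f t \<longrightarrow>
        ((\<lambda>s. (f t - f s) / (t - s) * t powr (1 - \<alpha>)) \<longlongrightarrow> conf_deriv T \<alpha> f t) (at t within T))"
    if "0 < t" "right_dense T t"
  proof -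
    note iff = has_conf_deriv_pos_right_dense[OF \<open>t \<in> T\<close> that(2)]
    have "((\<lambda>s. (f t - f s) / (t - s) * t powr (1 - \<alpha>)) \<longlongrightarrow> conf_deriv T \<alpha> f t) (at t within T)"
      if D: "has_conf_deriv_pos T \<alpha> f D t" for D
    proof (cases "at t within T = bot")
      case False
      then have "conf_deriv T \<alpha> f t = D"
        using conf_deriv_eqI assms(4) \<open>0 < t\<close> D by blast
      then show ?thesis
        using D iff by simp
    qed simp
    then show ?thesis
      using iff iff_pos[OF \<open>0 < t\<close>] by (auto simp: conf_differentiable_def)
  qed
  ultimately show ?thesis
    using conf_differentiable_imp_jump_formula[OF assms(4)] by blast
qed

end
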